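(* Let $X$ be a complex Banach sequence space such that its canonical basis is a 1-unconditional Schauder basis, suppose that the group $R$ acts continuously on $X$, and suppose that the closed unit ball $\overline{B_X}$ is $R$-invariant (or $R_F$-invariant). If $z$ is an element of $X$ outside $\overline{B_X}$, then $z$ can be separated from $\overline{B_X}$ by a homogeneous $R$-invariant (or, respectively, $R_F$-invariant) continuous polynomial.
   Context: $R$ is the group of operators on $X$ of the form $\gamma(z)=(z_1,e^{2\pi i k_2/2}z_2,\ldots,e^{2\pi i k_m/m}z_m,\ldots)$ for $z=(z_m)_{m\in\mathbb{N}}\in X$, where $k_2,k_3,\ldots\in\mathbb{N}\cup\{0\}$ are arbitrary. $R_F$ is the subgroup of $R$ generated by $\{\gamma_m\}_{m\in\mathbb{N}}$, where $\gamma_m(z)=(z_1,\ldots,z_{m-1},e^{2\pi i/m}z_m,z_{m+1},\ldots)$. "$R$ acts continuously on $X$" means that $R$ consists of continuous linear operators on $X$ and is endowed with a topology making it a topological group for which $(\gamma,x)\mapsto\gamma(x)$ is continuous. A set $K$ is invariant under a group $G$ of operators if $\gamma(K)\subset K$ for every $\gamma\in G$; a (complex-valued) polynomial $P$ is $G$-invariant if $P\circ\gamma=P$ for every $\gamma\in G$. A polynomial $P$ separates a point $z$ and a set $K$ if $\sup_{w\in K}|P(w)|<|P(z)|$. *)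

theory Defs
  imports
    "HOL-Analysis.Analysis"
    "HOL-Library.Function_Algebras"
    "HOL-Algebra.Bij"
    "HOL-Algebra.Generated_Groups"
begin

text \<open>
  Sequences are functions \<open>nat \<Rightarrow> complex\<close> with the pointwise operations of
  \<^theory>\<open>HOL-Library.Function_Algebras\<close>.  Indices are shifted by one: \<open>z i\<close> is the
  coordinate usually written with subscript \<open>i + 1\<close>.  A sequence space is a carrier
  set \<open>X\<close> with a norm \<open>nrm\<close>, whose values outside \<open>X\<close> are irrelevant.
\<close>

type_synonym cseq = "nat \<Rightarrow> complex"

definition cscale :: "complex \<Rightarrow> cseq \<Rightarrow> cseq"  (infixr \<open>*\<^sub>c\<close> 75)
  where "c *\<^sub>c x = (\<lambda>i. c * x i)"

definition unit_seq :: "nat \<Rightarrow> cseq"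
  where "unit_seq n = (\<lambda>i. if i = n then 1 else 0)"

text \<open>\<^locale>\<open>Metric_space\<close> demands symmetry and nonnegativity also off the carrier, hence the
  case distinction.\<close>

definition seq_dist :: "cseq set \<Rightarrow> (cseq \<Rightarrow> real) \<Rightarrow> cseq \<Rightarrow> cseq \<Rightarrow> real"
  where "seq_dist X nrm x y = (if x \<in> X \<and> y \<in> X then nrm (x - y) else 0)"

abbreviation norm_topology :: "cseq set \<Rightarrow> (cseq \<Rightarrow> real) \<Rightarrow> cseq topology"
  where "norm_topology X nrm \<equiv> Metric_space.mtopology X (seq_dist X nrm)"

locale complex_normed_sequence_space =
  fixes X :: "cseq set" and nrm :: "cseq \<Rightarrow> real"
  assumes subspace: "module.subspace cscale X"
    and norm_nonneg: "x \<in> X \<Longrightarrow> 0 \<le> nrm x"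
    and norm_eq_zero: "x \<in> X \<Longrightarrow> nrm x = 0 \<longleftrightarrow> x = 0"
    and norm_triangle: "x \<in> X \<Longrightarrow> y \<in> X \<Longrightarrow> nrm (x + y) \<le> nrm x + nrm y"
    and norm_scale: "x \<in> X \<Longrightarrow> nrm (c *\<^sub>c x) = cmod c * nrm x"

interpretation cseq: vector_space cscale
  by standard (auto simp: cscale_def fun_eq_iff algebra_simps)

sublocale complex_normed_sequence_space \<subseteq> Metric_space X "seq_dist X nrm"
proof
  have diff: "x - y \<in> X" if "x \<in> X" "y \<in> X" for x y
    using that subspace by (rule cseq.subspace_diff[rotated])
  show "0 \<le> seq_dist X nrm x y" for x y
    by (simp add: seq_dist_def diff norm_nonneg)
  show "seq_dist X nrm x y = seq_dist X nrm y x" for x y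
  proof (cases "x \<in> X \<and> y \<in> X")
    case True
    have "y - x = (-1) *\<^sub>c (x - y)"
      by (simp add: cscale_def fun_eq_iff)
    then show ?thesis
      using True norm_scale[of "x - y" "-1"] diff by (simp add: seq_dist_def)
  qed (auto simp: seq_dist_def)
  show "seq_dist X nrm x y = 0 \<longleftrightarrow> x = y" if "x \<in> X" "y \<in> X" for x y
    using that by (simp add: seq_dist_def norm_eq_zero diff)
  show "seq_dist X nrm x z \<le> seq_dist X nrm x y + seq_dist X nrm y z"
    if "x \<in> X" "y \<in> X" "z \<in> X" for x y z
    using that norm_triangle[of "x - y" "y - z"] by (simp add: seq_dist_def diff)
qed

locale complex_banach_sequence_space = complex_normed_sequence_space +
  assumes complete: "mcomplete"
    and continuous_coordinates: "continuous_map mtopology euclidean (\<lambda>x. x i)"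

definition expands_as ::
    "cseq set \<Rightarrow> (cseq \<Rightarrow> real) \<Rightarrow> (nat \<Rightarrow> cseq) \<Rightarrow> (nat \<Rightarrow> complex) \<Rightarrow> cseq \<Rightarrow> bool"
  where "expands_as X nrm b a x \<longleftrightarrow>
    limitin (norm_topology X nrm) (\<lambda>N. \<Sum>n<N. a n *\<^sub>c b n) x sequentially"

definition schauder_basis :: "cseq set \<Rightarrow> (cseq \<Rightarrow> real) \<Rightarrow> (nat \<Rightarrow> cseq) \<Rightarrow> bool"
  where "schauder_basis X nrm b \<longleftrightarrow>
    range b \<subseteq> X \<and> (\<forall>x\<in>X. \<exists>!a. expands_as X nrm b a x)"

definition unconditional_basis :: "cseq set \<Rightarrow> (cseq \<Rightarrow> real) \<Rightarrow> (nat \<Rightarrow> cseq) \<Rightarrow> bool"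
  where "unconditional_basis X nrm b \<longleftrightarrow>
    schauder_basis X nrm b \<and>
    (\<forall>x\<in>X. \<forall>a. expands_as X nrm b a x \<longrightarrow>
      (\<forall>\<pi>. bij \<pi> \<longrightarrow> expands_as X nrm (b \<circ> \<pi>) (a \<circ> \<pi>) x))"

text \<open>The unconditional constant is the supremum of the norms of the sign-change operators,
  with signs \<open>\<plusminus>1\<close> also over the complex field.  Unimodular complex multipliers would be a
  stronger requirement.\<close>

definition one_unconditional_basis :: "cseq set \<Rightarrow> (cseq \<Rightarrow> real) \<Rightarrow> (nat \<Rightarrow> cseq) \<Rightarrow> bool"
  where "one_unconditional_basis X nrm b \<longleftrightarrow>
    unconditional_basis X nrm b \<and>
    (\<forall>a \<theta> x y. range \<theta> \<subseteq> {1, -1} \<and> expands_as X nrm b a x \<and>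
        expands_as X nrm b (\<lambda>n. \<theta> n * a n) y \<longrightarrow> nrm y \<le> nrm x)"

definition unit_cball :: "cseq set \<Rightarrow> (cseq \<Rightarrow> real) \<Rightarrow> cseq set"
  where "unit_cball X nrm = {x \<in> X. nrm x \<le> 1}"

text \<open>Operators on \<open>X\<close> are extensional functions, as in \<^const>\<open>BijGroup\<close>.\<close>

definition rotation :: "cseq set \<Rightarrow> (nat \<Rightarrow> nat) \<Rightarrow> cseq \<Rightarrow> cseq"
  where "rotation X k =
    (\<lambda>z\<in>X. \<lambda>i. exp (2 * of_real pi * \<i> * of_nat (k i) / of_nat (i + 1)) * z i)"

definition R_group :: "cseq set \<Rightarrow> (cseq \<Rightarrow> cseq) set"
  where "R_group X = range (rotation X)"

definition RF_generator :: "cseq set \<Rightarrow> nat \<Rightarrow> cseq \<Rightarrow> cseq"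
  where "RF_generator X m = rotation X (\<lambda>i. if i = m then 1 else 0)"

definition RF_group :: "cseq set \<Rightarrow> (cseq \<Rightarrow> cseq) set"
  where "RF_group X = generate (BijGroup X) (range (RF_generator X))"

definition topological_group :: "('g, 'r) monoid_scheme \<Rightarrow> 'g topology \<Rightarrow> bool"
  where "topological_group G T \<longleftrightarrow>
    group G \<and> topspace T = carrier G \<and>
    continuous_map (prod_topology T T) T (\<lambda>(g, h). g \<otimes>\<^bsub>G\<^esub> h) \<and>
    continuous_map T T (\<lambda>g. inv\<^bsub>G\<^esub> g)"

definition continuous_linear_operator ::
    "cseq set \<Rightarrow> (cseq \<Rightarrow> real) \<Rightarrow> (cseq \<Rightarrow> cseq) \<Rightarrow> bool"
  where "continuous_linear_operator X nrm f \<longleftrightarrow>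
    (\<forall>x\<in>X. \<forall>y\<in>X. f (x + y) = f x + f y) \<and>
    (\<forall>c. \<forall>x\<in>X. f (c *\<^sub>c x) = c *\<^sub>c f x) \<and>
    continuous_map (norm_topology X nrm) (norm_topology X nrm) f"

definition acts_continuously ::
    "cseq set \<Rightarrow> (cseq \<Rightarrow> real) \<Rightarrow> (cseq \<Rightarrow> cseq) set \<Rightarrow> bool"
  where "acts_continuously X nrm \<Gamma> \<longleftrightarrow>
    subgroup \<Gamma> (BijGroup X) \<and>
    (\<forall>\<gamma>\<in>\<Gamma>. continuous_linear_operator X nrm \<gamma>) \<and>
    (\<exists>T. topological_group ((BijGroup X)\<lparr>carrier := \<Gamma>\<rparr>) T \<and>
      continuous_map (prod_topology T (norm_topology X nrm)) (norm_topology X nrm)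
        (\<lambda>(\<gamma>, x). \<gamma> x))"

definition invariant_set :: "(cseq \<Rightarrow> cseq) set \<Rightarrow> cseq set \<Rightarrow> bool"
  where "invariant_set \<Gamma> K \<longleftrightarrow> (\<forall>\<gamma>\<in>\<Gamma>. \<gamma> ` K \<subseteq> K)"

text \<open>The arguments of a \<open>k\<close>-linear form are families in \<open>X\<close> indexed by \<open>{..<k}\<close>.\<close>

definition multilinear_form :: "cseq set \<Rightarrow> nat \<Rightarrow> ((nat \<Rightarrow> cseq) \<Rightarrow> complex) \<Rightarrow> bool"
  where "multilinear_form X k A \<longleftrightarrow>
    (\<forall>v \<in> {..<k} \<rightarrow>\<^sub>E X. \<forall>j<k. \<forall>x\<in>X. \<forall>y\<in>X. \<forall>c.
      A (v(j := c *\<^sub>c x + y)) = c * A (v(j := x)) + A (v(j := y)))"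

definition homogeneous_polynomial :: "cseq set \<Rightarrow> nat \<Rightarrow> (cseq \<Rightarrow> complex) \<Rightarrow> bool"
  where "homogeneous_polynomial X k P \<longleftrightarrow>
    (\<exists>A. multilinear_form X k A \<and> (\<forall>x\<in>X. P x = A (\<lambda>j\<in>{..<k}. x)))"

definition continuous_homogeneous_polynomial ::
    "cseq set \<Rightarrow> (cseq \<Rightarrow> real) \<Rightarrow> nat \<Rightarrow> (cseq \<Rightarrow> complex) \<Rightarrow> bool"
  where "continuous_homogeneous_polynomial X nrm k P \<longleftrightarrow>
    homogeneous_polynomial X k P \<and> continuous_map (norm_topology X nrm) euclidean P"

definition invariant_function ::
    "cseq set \<Rightarrow> (cseq \<Rightarrow> cseq) set \<Rightarrow> (cseq \<Rightarrow> complex) \<Rightarrow> bool"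
  where "invariant_function X \<Gamma> P \<longleftrightarrow> (\<forall>\<gamma>\<in>\<Gamma>. \<forall>x\<in>X. P (\<gamma> x) = P x)"

text \<open>The supremum is taken in \<^typ>\<open>ereal\<close>, so that it is infinite if \<open>P\<close> is unbounded on \<open>K\<close>.\<close>

definition separates :: "(cseq \<Rightarrow> complex) \<Rightarrow> cseq \<Rightarrow> cseq set \<Rightarrow> bool"
  where "separates P z K \<longleftrightarrow> (SUP w\<in>K. ereal (cmod (P w))) < ereal (cmod (P z))"

end

theory Submission
  imports Defs
begin

text \<open>
  Truncation \<open>P\<^sub>N\<close> is a contraction and \<open>P\<^sub>N z \<rightarrow> z\<close>, so some truncation of \<open>z\<close> still lies
  outside the ball. Hahn--Banach for the seminorm \<open>x \<mapsto> \<parallel>P\<^sub>N x\<parallel>\<close> gives a linear form \<open>f\<close>, bounded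
  by 1 on the ball, with \<open>\<bar>f z\<bar> > 1\<close>. On the first \<open>N\<close> coordinates \<open>R\<close> acts through a finite
  group \<open>G\<close>, so \<open>P x = (\<Sum>g\<in>G. f (g (P\<^sub>N x)) ^ k)\<close> is an \<open>R\<close>-invariant homogeneous polynomial with
  \<open>\<bar>P\<bar> \<le> card G\<close> on the ball. Dirichlet's simultaneous approximation theorem provides a large
  \<open>k\<close> for which all the powers \<open>f (g (P\<^sub>N z)) ^ k\<close> have arguments close to 0; they cannot
  cancel, and \<open>\<bar>P z\<bar> > card G\<close>.
\<close>

section \<open>The Hahn--Banach theorem for a seminorm\<close>

text \<open>The scalar multiplication \<open>s\<close> is a parameter because the real scalars are
  later taken from a complex scalar multiplication. The one-sided bound under positive scaling gives
  equality when applied to \<open>1/c\<close> as well.\<close>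

definition sublinear :: "(real \<Rightarrow> 'a \<Rightarrow> 'a) \<Rightarrow> ('a::ab_group_add \<Rightarrow> real) \<Rightarrow> bool"
  where "sublinear s p \<longleftrightarrow>
    (\<forall>x y. p (x + y) \<le> p x + p y) \<and> (\<forall>c>0. \<forall>x. p (s c x) \<le> c * p x)"

context
  fixes s :: "real \<Rightarrow> 'a::ab_group_add \<Rightarrow> 'a"
  assumes vs: "vector_space s"
begin

interpretation vector_space s by (rule vs)

lemma sublinear_add: "sublinear s p \<Longrightarrow> p (x + y) \<le> p x + p y"
  by (auto simp: sublinear_def)

lemma sublinear_scale:
  assumes p: "sublinear s p" and c: "c > 0"
  shows "p (s c x) = c * p x"
proof (rule antisym)
  show "p (s c x) \<le> c * p x" using assms by (auto simp: sublinear_def)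
  have "p (s (1/c) (s c x)) \<le> (1/c) * p (s c x)"
    using assms by (metis sublinear_def zero_less_divide_1_iff)
  then show "c * p x \<le> p (s c x)" using c by (simp add: field_simps)
qed

lemma sublinear_zero: "sublinear s p \<Longrightarrow> p 0 = 0"
  using sublinear_scale[of p 2 0] by simp

lemma sublinear_minus: "sublinear s p \<Longrightarrow> - p (- x) \<le> p x"
  using sublinear_add[of p x "- x"] sublinear_zero[of p] by simp

text \<open>The largest sublinear functional below \<open>p\<close> that is linear on the line through \<open>v\<close>
  with value \<open>p v\<close> at \<open>v\<close>.\<close>

definition linearize_at :: "('a \<Rightarrow> real) \<Rightarrow> 'a \<Rightarrow> 'a \<Rightarrow> real"
  where "linearize_at p v x = (INF t\<in>{0<..}. p (x + s t v) - t * p v)"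

lemma linearize_at_le:
  assumes p: "sublinear s p" and t: "t > 0"
  shows "linearize_at p v x \<le> p (x + s t v) - t * p v"
  unfolding linearize_at_def
proof (rule cINF_lower)
  show "bdd_below ((\<lambda>t. p (x + s t v) - t * p v) ` {0<..})"
  proof (rule bdd_belowI2)
    fix t :: real assume "t \<in> {0<..}"
    \<comment> \<open>From \<open>t * p v = p (s t v)\<close> and
      \<open>s t v = (x + s t v) + (- x)\<close>; so the infimum is over a set that is bounded
      below.\<close>
    then show "- p (- x) \<le> p (x + s t v) - t * p v"
      using sublinear_add[OF p, of "x + s t v" "- x"] sublinear_scale[OF p, of t v] by simp
  qed
qed (use t in auto)

lemma le_linearize_at:
  "(\<And>t. t > 0 \<Longrightarrow> m \<le> p (x + s t v) - t * p v) \<Longrightarrow> m \<le> linearize_at p v x"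
  unfolding linearize_at_def by (rule cINF_greatest) auto

lemma linearize_at_below:
  assumes p: "sublinear s p"
  shows "linearize_at p v x \<le> p x"
  using linearize_at_le[OF p zero_less_one, of v x] sublinear_add[OF p, of x v] by simp

text \<open>At \<open>t = 1\<close> the infimum sees \<open>p 0 - p v\<close>. Since
  \<open>sublinear_minus\<close> gives the opposite bound, this makes functionals equal to their own
  linearization odd.\<close>

lemma linearize_at_minus:
  assumes p: "sublinear s p"
  shows "linearize_at p v (- v) \<le> - p v"
  using linearize_at_le[OF p zero_less_one, of v "- v"] sublinear_zero[OF p] by simp

lemma sublinear_linearize_at:
  assumes p: "sublinear s p"
  shows "sublinear s (linearize_at p v)"
  unfolding sublinear_def
proof (intro conjI allI impI)
  fix x y
  let ?L = "linearize_at p v"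
  \<comment> \<open>Parameters \<open>t\<close> for \<open>x\<close> and \<open>u\<close> for
    \<open>y\<close> combine to \<open>t + u\<close> for \<open>x + y\<close>; the infima over
    \<open>t\<close> and \<open>u\<close> are then taken one after the other.\<close>
  have *: "?L (x + y) - (p (y + s u v) - u * p v) \<le> p (x + s t v) - t * p v"
    if "t > 0" "u > 0" for t u
    using linearize_at_le[OF p, of "t + u" v "x + y"] that
      sublinear_add[OF p, of "x + s t v" "y + s u v"]
    by (simp add: algebra_simps)
  have "?L (x + y) - (p (y + s u v) - u * p v) \<le> ?L x" if "u > 0" for u
    by (rule le_linearize_at) (use * that in auto)
  then have "?L (x + y) - ?L x \<le> ?L y"
    by (intro le_linearize_at) (force simp: algebra_simps)
  then show "?L (x + y) \<le> ?L x + ?L y" by simp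
next
  fix c :: real and x assume c: "c > 0"
  let ?L = "linearize_at p v"
  have "?L (s c x) / c \<le> ?L x"
  proof (rule le_linearize_at)
    fix t :: real assume t: "t > 0"
    have "?L (s c x) \<le> p (s c x + s (c * t) v) - c * t * p v"
      by (rule linearize_at_le[OF p]) (use c t in auto)
    also have "p (s c x + s (c * t) v) = c * p (x + s t v)"
      using sublinear_scale[OF p c, of "x + s t v"] by (simp add: scale_right_distrib)
    finally show "?L (s c x) / c \<le> p (x + s t v) - t * p v"
      using c by (simp add: field_simps)
  qed
  then show "?L (s c x) \<le> c * ?L x" using c by (simp add: field_simps)
qed

text \<open>Zorn's lemma for the reversed pointwise order. A nonempty chain is bounded by its
  pointwise infimum, which is finite because each member \<open>r\<close> satisfies
  \<open>- p (- x) \<le> - r (- x) \<le> r x\<close>.\<close>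

lemma ex_minimal_sublinear:
  assumes p: "sublinear s p"
  obtains q where "sublinear s q" "q \<le> p" "\<And>r. sublinear s r \<Longrightarrow> r \<le> q \<Longrightarrow> r = q"
proof -
  define A where "A = {q. sublinear s q \<and> q \<le> p}"
  have "\<exists>m\<in>A. \<forall>a\<in>A. m \<ge> a \<longrightarrow> a = m"
  proof (rule predicate_Zorn)
    show "partial_order_on A (relation_of (\<ge>) A)"
      by (rule partial_order_on_relation_ofI) auto
  next
    fix C assume C: "C \<in> Chains (relation_of (\<ge>) A)"
    then have CA: "\<And>q. q \<in> C \<Longrightarrow> q \<in> A"
      and tot: "\<And>q r. q \<in> C \<Longrightarrow> r \<in> C \<Longrightarrow> q \<le> r \<or> r \<le> q"
      by (auto simp: Chains_def relation_of_def)
    show "\<exists>u\<in>A. \<forall>a\<in>C. u \<le> a"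
    proof (cases "C = {}")
      case True
      then show ?thesis using p by (auto simp: A_def)
    next
      case False
      define u where "u x = (INF q\<in>C. q x)" for x
      have u_le: "u x \<le> q x" if "q \<in> C" for q x
        unfolding u_def
      proof (rule cINF_lower)
        show "bdd_below ((\<lambda>q. q x) ` C)"
        proof (rule bdd_belowI2)
          fix r assume "r \<in> C"
          then have "sublinear s r" "r (- x) \<le> p (- x)"
            using CA by (auto simp: A_def le_fun_def)
          then show "- p (- x) \<le> r x" using sublinear_minus[of r x] by simp
        qed
      qed (use that in auto)
      have le_u: "m \<le> u x" if "\<And>q. q \<in> C \<Longrightarrow> m \<le> q x" for m x
        unfolding u_def by (rule cINF_greatest) (use that False in auto)
      have "sublinear s u"
        unfolding sublinear_def
      proof (intro conjI allI impI)
        fix x y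
        \<comment> \<open>\<open>q\<close> and \<open>r\<close> are tested at different points; the
          smaller of the two, \<open>w\<close>, serves at both.\<close>
        have *: "u (x + y) - r y \<le> q x" if qr: "q \<in> C" "r \<in> C" for q r
        proof -
          obtain w where w: "w \<in> C" "w \<le> q" "w \<le> r"
            using tot[OF qr] qr by blast
          have "u (x + y) \<le> w x + w y"
            using u_le[OF w(1), of "x + y"] sublinear_add[of w x y] CA[OF w(1)]
            by (simp add: A_def)
          moreover have "w x \<le> q x" "w y \<le> r y" using w by (auto simp: le_fun_def)
          ultimately show ?thesis by linarith
        qed
        have "u (x + y) - r y \<le> u x" if "r \<in> C" for r
          by (rule le_u) (use * that in auto)
        then have "u (x + y) - u x \<le> u y"
          by (intro le_u) (force simp: algebra_simps)
        then show "u (x + y) \<le> u x + u y" by simp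
      next
        fix c :: real and x assume c: "c > 0"
        have "u (s c x) / c \<le> u x"
        proof (rule le_u)
          fix q assume q: "q \<in> C"
          then show "u (s c x) / c \<le> q x"
            using u_le[OF q, of "s c x"] sublinear_scale[of q c x] c CA[OF q]
            by (simp add: A_def field_simps)
        qed
        then show "u (s c x) \<le> c * u x" using c by (simp add: field_simps)
      qed
      moreover have "u \<le> p"
        using False u_le CA unfolding A_def le_fun_def
        by (metis (mono_tags, lifting) ex_in_conv mem_Collect_eq order_trans)
      ultimately show ?thesis using u_le by (auto simp: A_def le_fun_def)
    qed
  qed
  then obtain q where "q \<in> A" and *: "\<forall>a\<in>A. a \<le> q \<longrightarrow> a = q" by blast
  then show thesis
    by (intro that[of q]) (auto simp: A_def)
qed

text \<open>A minimal sublinear \<open>q\<close> equals its linearization at every \<open>v\<close>,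
  hence is odd, hence linear. Searching for \<open>q\<close> below \<open>linearize_at p z\<close>
  instead of \<open>p\<close> is what forces \<open>q z = p z\<close>.\<close>

theorem Hahn_Banach_sublinear:
  assumes p: "sublinear s p"
  obtains g where "\<And>x y. g (x + y) = g x + g y" "\<And>c x. g (s c x) = c * g x"
    "\<And>x. g x \<le> p x" "g z = p z"
proof -
  obtain q where q: "sublinear s q" "q \<le> linearize_at p z"
    and min: "\<And>r. sublinear s r \<Longrightarrow> r \<le> q \<Longrightarrow> r = q"
    using ex_minimal_sublinear[OF sublinear_linearize_at[OF p]] by blast
  have minus: "q (- v) = - q v" for v
  proof -
    have "linearize_at q v = q"
      using sublinear_linearize_at[OF q(1)] linearize_at_below[OF q(1)]
      by (intro min) (auto simp: le_fun_def)
    then show ?thesis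
      using linearize_at_minus[OF q(1), of v] sublinear_minus[OF q(1), of v] by simp
  qed
  have le: "q x \<le> p x" for x
    using q(2) linearize_at_below[OF p, of z x] by (force simp: le_fun_def intro: order_trans)
  show thesis
  proof (rule that[of q])
    \<comment> \<open>Writing \<open>x = (x + y) + (- y)\<close> and using oddness reverses the
      subadditivity.\<close>
    show "q (x + y) = q x + q y" for x y
      using sublinear_add[OF q(1), of x y] sublinear_add[OF q(1), of "x + y" "- y"] minus[of y]
      by simp
    show "q (s c x) = c * q x" for c x
    proof (cases "c = 0" "c > 0" rule: bool.exhaust[case_product bool.exhaust])
      case True_True
      then show ?thesis by simp
    next
      case True_False
      then show ?thesis using sublinear_zero[OF q(1)] by simp
    next
      case False_True
      then show ?thesis using sublinear_scale[OF q(1)] by simp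
    next
      case False_False
      then show ?thesis using sublinear_scale[OF q(1), of "- c" x] minus[of "s c x"] by simp
    qed
    have "- q z \<le> - p z"
      using q(2) linearize_at_minus[OF p, of z] minus[of z]
      by (metis le_fun_def order_trans)
    then show "q z = p z" using le[of z] by simp
  qed (rule le)
qed

end

text \<open>A real form \<open>g\<close> dominated by \<open>p\<close> is complexified to
  \<open>f x = g x - \<i> * g (s \<i> x)\<close>; rotating the argument carries the bound over to
  the modulus of \<open>f\<close>.\<close>

theorem complex_Hahn_Banach_seminorm:
  fixes s :: "complex \<Rightarrow> 'a::ab_group_add \<Rightarrow> 'a" and p :: "'a \<Rightarrow> real"
  assumes vs: "vector_space s"
    and tri: "\<And>x y. p (x + y) \<le> p x + p y" and scl: "\<And>c x. p (s c x) = cmod c * p x"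
  obtains f where "\<And>x y. f (x + y) = f x + f y" "\<And>c x. f (s c x) = c * f x"
    "\<And>x. cmod (f x) \<le> p x" "f z = of_real (p z)"
proof -
  interpret vector_space s by (rule vs)
  define sr where "sr r = s (of_real r)" for r :: real
  have "vector_space sr"
    by standard (auto simp: sr_def algebra_simps)
  moreover have "sublinear sr p"
    by (auto simp: sublinear_def sr_def tri scl)
  ultimately obtain g where add: "\<And>x y. g (x + y) = g x + g y"
    and gs: "\<And>r x. g (s (of_real r) x) = r * g x" and le: "\<And>x. g x \<le> p x" and gz: "g z = p z"
    unfolding sr_def by (rule Hahn_Banach_sublinear[of _ _ z]) blast
  define f where "f x = Complex (g x) (- g (s \<i> x))" for x
  have f_add: "f (x + y) = f x + f y" for x y
    by (simp add: f_def add scale_right_distrib complex_eq_iff)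
  have f_scale: "f (s c x) = c * f x" for c x
  proof -
    have g_c: "g (s c x) = Re c * g x + Im c * g (s \<i> x)" for c x
    proof -
      have "s c x = s (of_real (Re c)) x + s (of_real (Im c)) (s \<i> x)"
        by (simp flip: scale_left_distrib) (metis complex_eq mult.commute)
      then show ?thesis by (simp only: add gs)
    qed
    show ?thesis
      \<comment> \<open>The real part of the claim is \<open>g_c\<close> at \<open>c\<close>, the
        imaginary part is \<open>g_c\<close> at \<open>\<i> * c\<close>.\<close>
      using g_c[of c x] g_c[of "\<i> * c" x] by (simp add: f_def complex_eq_iff)
  qed
  have f_le: "cmod (f x) \<le> p x" for x
  proof (cases "f x = 0")
    case True
    then have "g x = 0" by (simp add: f_def complex_eq_iff)
    then show ?thesis using le[of x] True by simp
  next
    case False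
    \<comment> \<open>This unimodular factor makes the value of \<open>f\<close> a nonnegative real,
      equal to its real part and so to the value of \<open>g\<close>.\<close>
    let ?c = "cnj (sgn (f x))"
    have "f (s ?c x) = of_real (cmod (f x))"
      using False by (simp add: f_scale sgn_div_norm complex_norm_square[symmetric]
          power2_eq_square scaleR_conv_of_real mult.commute field_simps)
    then have "cmod (f x) = g (s ?c x)" by (simp add: f_def complex_eq_iff)
    also have "\<dots> \<le> p (s ?c x)" by (rule le)
    also have "\<dots> = p x" using False by (simp add: scl norm_sgn)
    finally show ?thesis .
  qed
  \<comment> \<open>The real part already attains the bound \<open>p z\<close> on the modulus, so
    the imaginary part vanishes.\<close>
  have "Re (f z) = p z" by (simp add: f_def gz)
  then have "f z = of_real (p z)"
    using f_le[of z] cmod_power2[of "f z"]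
    by (smt (verit) abs_norm_cancel complex_eq_iff complex_Re_le_cmod Re_complex_of_real Im_complex_of_real
        cmod_eq_Re power2_eq_iff_nonneg norm_ge_zero zero_eq_power2)
  with that f_add f_scale f_le show thesis by blast
qed

section \<open>Power sums\<close>

lemma ex_power_Re_ge_half:
  fixes b :: "'i \<Rightarrow> complex"
  assumes "finite S"
  obtains q :: nat where "q > 0" "\<And>i. i \<in> S \<Longrightarrow> cmod (b i) ^ q / 2 \<le> Re (b i ^ q)"
proof -
  obtain h where h: "bij_betw h {..<card S} S"
    using ex_bij_betw_nat_finite[OF assms] by (auto simp: atLeast0LessThan)
  \<comment> \<open>An error below 1/6 of a full turn is an angle below \<open>pi / 3\<close>, whose
    cosine is at least 1/2.\<close>
  obtain q p where q: "0 < q"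
    and qp: "\<And>i. i < card S \<Longrightarrow> \<bar>of_int q * (Arg (b (h i)) / (2 * pi)) - of_int (p i)\<bar> < 1 / real 6"
    by (rule Dirichlet_approx_simult[of 6 "card S" "\<lambda>i. Arg (b (h i)) / (2 * pi)"]) auto
  show thesis
  proof (rule that[of "nat q"])
    show "nat q > 0" using q by simp
    fix i assume "i \<in> S"
    then obtain j where j: "j < card S" "i = h j"
      using h by (auto simp: bij_betw_def)
    define \<alpha> where "\<alpha> = real (nat q) * Arg (b i)"
    define \<delta> where "\<delta> = \<alpha> - 2 * pi * of_int (p j)"
    have "\<delta> = 2 * pi * (of_int q * (Arg (b i) / (2 * pi)) - of_int (p j))"
      using q by (simp add: \<delta>_def \<alpha>_def field_simps)
    then have "\<bar>\<delta>\<bar> \<le> 2 * pi * (1 / 6)"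
      using qp[OF j(1)] j(2) by (simp add: abs_mult)
    then have "cos (pi / 3) \<le> cos \<bar>\<delta>\<bar>"
      by (intro cos_monotone_0_pi_le) auto
    then have "1 / 2 \<le> cos \<delta>" by (simp add: cos_60)
    also have "cos \<delta> = cos \<alpha>"
      using cos_int_2pin[of "p j"] sin_int_2pin[of "p j"]
      by (simp add: \<delta>_def cos_diff mult.commute)
    finally have "1 / 2 \<le> cos \<alpha>" .
    moreover have "b i ^ nat q = rcis (cmod (b i) ^ nat q) \<alpha>"
      by (metis DeMoivre2 rcis_cmod_Arg \<alpha>_def)
    then have "Re (b i ^ nat q) = cmod (b i) ^ nat q * cos \<alpha>" by simp
    ultimately show "cmod (b i) ^ nat q / 2 \<le> Re (b i ^ nat q)"
      using mult_left_mono[of "1 / 2" "cos \<alpha>" "cmod (b i) ^ nat q"] by simp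
  qed
qed

text \<open>A first exponent \<open>l\<close> makes the term at \<open>j\<close> large. A second
  one, \<open>q\<close>, chosen after \<open>l\<close> because it depends on the arguments of
  \<open>a i ^ l\<close>, gives all terms nonnegative real part, so nothing cancels.\<close>

lemma ex_large_power_sum:
  fixes a :: "'i \<Rightarrow> complex"
  assumes S: "finite S" and j: "j \<in> S" and large: "1 < cmod (a j)"
  obtains k where "M < cmod (\<Sum>i\<in>S. a i ^ k)"
proof -
  \<comment> \<open>Exceeding 1 keeps \<open>cmod (a j) ^ l\<close> from shrinking under the later
    power \<open>q\<close>; the factor 2 pays for the 1/2 in the bound on real parts.\<close>
  obtain l where l: "max 1 (2 * M) < cmod (a j) ^ l"
    using real_arch_pow[OF large] by blast
  obtain q where q: "q > 0"
    and Re: "\<And>i. i \<in> S \<Longrightarrow> cmod (a i ^ l) ^ q / 2 \<le> Re ((a i ^ l) ^ q)"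
    using ex_power_Re_ge_half[OF S, of "\<lambda>i. a i ^ l"] by blast
  have "M < cmod (a j) ^ l / 2" using l by simp
  also have "\<dots> \<le> cmod (a j ^ l) ^ q / 2"
    using l q self_le_power[of "cmod (a j) ^ l" q] by (simp add: norm_power)
  also have "\<dots> \<le> Re ((a j ^ l) ^ q)" by (rule Re[OF j])
  also have "\<dots> \<le> (\<Sum>i\<in>S. Re ((a i ^ l) ^ q))"
  proof (rule member_le_sum[OF j])
    show "0 \<le> Re ((a i ^ l) ^ q)" if "i \<in> S - {j}" for i
      using Re[of i] that by (smt (verit) DiffD1 divide_nonneg_nonneg norm_ge_zero zero_le_power)
  qed (use S in auto)
  also have "\<dots> = Re (\<Sum>i\<in>S. a i ^ (l * q))" by (simp add: power_mult)
  also have "\<dots> \<le> cmod (\<Sum>i\<in>S. a i ^ (l * q))" by (rule complex_Re_le_cmod)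
  finally show thesis by (rule that)
qed

section \<open>Coordinate truncations\<close>

definition truncate_seq :: "nat \<Rightarrow> cseq \<Rightarrow> cseq"
  where "truncate_seq N x = (\<lambda>i. if i < N then x i else 0)"

lemma sum_unit_seq: "(\<Sum>n<N. a n *\<^sub>c unit_seq n) = truncate_seq N a"
  by (induction N)
     (auto simp: truncate_seq_def cscale_def unit_seq_def fun_eq_iff less_Suc_eq)

locale one_unconditional_sequence_space = complex_banach_sequence_space +
  assumes basis: "one_unconditional_basis X nrm unit_seq"
begin

lemmas X_add = cseq.subspace_add[OF subspace]
  and X_diff = cseq.subspace_diff[OF subspace]
  and X_scale = cseq.subspace_scale[OF subspace]

text \<open>A truncation is a finite combination of unit sequences, whatever \<open>x\<close> is.
  Hence the norm of the truncation is a seminorm on the whole type \<open>cseq\<close>, where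
  Hahn-Banach applies without a carrier set.\<close>

lemma truncate_seq_in_X: "truncate_seq N x \<in> X"
proof -
  have "unit_seq n \<in> X" for n
    using basis by (auto simp: one_unconditional_basis_def unconditional_basis_def schauder_basis_def)
  then show ?thesis
    unfolding sum_unit_seq[symmetric] by (intro cseq.subspace_sum[OF subspace] X_scale)
qed

text \<open>Coordinates are continuous, and the \<open>i\<close>-th coordinate of the partial sums
  is eventually \<open>a i\<close>; so the coefficients of an expansion are the coordinates of its
  limit.\<close>

lemma expands_as_self:
  assumes x: "x \<in> X"
  shows "expands_as X nrm unit_seq x x"
proof -
  obtain a where a: "expands_as X nrm unit_seq a x"
    using basis x
    by (auto simp: one_unconditional_basis_def unconditional_basis_def schauder_basis_def)
  have "a i = x i" for i
  proof -
    have "(\<lambda>N. truncate_seq N a i) \<longlonglongrightarrow> x i"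
      using continuous_map_limit[OF continuous_coordinates[of i]] a
      by (force simp: expands_as_def sum_unit_seq o_def)
    moreover have "(\<lambda>N. truncate_seq N a i) \<longlonglongrightarrow> a i"
      by (rule tendsto_eventually, rule eventually_mono[OF eventually_gt_at_top[of i]])
         (simp add: truncate_seq_def)
    ultimately show ?thesis using LIMSEQ_unique by blast
  qed
  then show ?thesis using a by (metis ext)
qed

text \<open>\<open>2 P\<^sub>N - 1\<close> is a sign-change operator, so \<open>P\<^sub>N\<close> is the mean of two contractions.\<close>

lemma norm_truncate_seq_le:
  assumes x: "x \<in> X"
  shows "nrm (truncate_seq N x) \<le> nrm x"
proof -
  define y where "y = 2 *\<^sub>c truncate_seq N x - x"
  define \<theta> :: "nat \<Rightarrow> complex" where "\<theta> i = (if i < N then 1 else - 1)" for i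
  have y: "y \<in> X" unfolding y_def by (intro X_diff X_scale truncate_seq_in_X x)
  have "y = (\<lambda>i. \<theta> i * x i)"
    by (auto simp: y_def \<theta>_def truncate_seq_def cscale_def fun_eq_iff)
  then have "nrm y \<le> nrm x"
    using basis expands_as_self[OF x] expands_as_self[OF y]
    unfolding one_unconditional_basis_def
    by (metis (mono_tags, lifting) \<theta>_def image_subsetI insertCI)
  moreover have "x + y = 2 *\<^sub>c truncate_seq N x" by (simp add: y_def)
  then have "2 * nrm (truncate_seq N x) \<le> nrm x + nrm y"
    using norm_triangle[OF x y] norm_scale[OF truncate_seq_in_X, of 2] by simp
  ultimately show ?thesis by simp
qed

lemma ex_norm_truncate_seq_gt:
  assumes z: "z \<in> X" and r: "r < nrm z"
  obtains N where "r < nrm (truncate_seq N z)"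
proof -
  have "limitin mtopology (\<lambda>N. truncate_seq N z) z sequentially"
    using expands_as_self[OF z] by (simp add: expands_as_def sum_unit_seq)
  then have "\<forall>\<epsilon>>0. \<exists>N. \<forall>n\<ge>N. truncate_seq n z \<in> X \<and> seq_dist X nrm (truncate_seq n z) z < \<epsilon>"
    by (auto simp: limit_metric_sequentially)
  moreover have "nrm z - r > 0" using r by simp
  ultimately obtain N where "seq_dist X nrm (truncate_seq N z) z < nrm z - r"
    by blast
  then have "nrm (z - truncate_seq N z) < nrm z - r"
    using z truncate_seq_in_X commute[of z "truncate_seq N z"] by (simp add: seq_dist_def)
  moreover have "nrm z \<le> nrm (z - truncate_seq N z) + nrm (truncate_seq N z)"
    using norm_triangle[OF X_diff[OF z truncate_seq_in_X[of N z]] truncate_seq_in_X[of N z]] by simp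
  ultimately show thesis by (intro that[of N]) simp
qed

end

section \<open>Invariant polynomials\<close>

text \<open>The product of the \<open>F s (v j)\<close> over \<open>j < k\<close> is
  \<open>k\<close>-linear in \<open>v\<close>, and on the diagonal it is a \<open>k\<close>-th
  power.\<close>

lemma homogeneous_polynomial_sum_power:
  assumes lin: "\<And>s c x y. s \<in> S \<Longrightarrow> F s (c *\<^sub>c x + y) = c * F s x + F s y"
  shows "homogeneous_polynomial X k (\<lambda>x. \<Sum>s\<in>S. F s x ^ k)"
  unfolding homogeneous_polynomial_def
proof (intro exI[of _ "\<lambda>v. \<Sum>s\<in>S. \<Prod>j<k. F s (v j)"] conjI ballI)
  show "multilinear_form X k (\<lambda>v. \<Sum>s\<in>S. \<Prod>j<k. F s (v j))"
    unfolding multilinear_form_def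
  proof (intro ballI allI impI)
    fix v :: "nat \<Rightarrow> cseq" and j x y c assume "j < k"
    then have "(\<Prod>i<k. F s ((v(j := u)) i)) = F s u * (\<Prod>i\<in>{..<k} - {j}. F s (v i))" for s u
      by (subst prod.remove[of _ j]) (auto intro!: prod.cong)
    then show "(\<Sum>s\<in>S. \<Prod>i<k. F s ((v(j := c *\<^sub>c x + y)) i)) =
      c * (\<Sum>s\<in>S. \<Prod>i<k. F s ((v(j := x)) i)) + (\<Sum>s\<in>S. \<Prod>i<k. F s ((v(j := y)) i))"
      by (simp add: lin sum_distrib_left sum.distrib[symmetric] distrib_right mult.assoc)
  qed
qed simp

lemma (in complex_normed_sequence_space) continuous_map_contraction:
  fixes F :: "cseq \<Rightarrow> complex"
  assumes "\<And>x y. x \<in> X \<Longrightarrow> y \<in> X \<Longrightarrow> cmod (F x - F y) \<le> nrm (x - y)"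
  shows "continuous_map mtopology euclidean F"
  unfolding continuous_map_from_metric
proof (intro conjI ballI allI impI)
  fix a U assume a: "a \<in> X" and "openin euclidean U \<and> F a \<in> U"
  then obtain e where e: "e > 0" "ball (F a) e \<subseteq> U" by (metis open_contains_ball open_openin)
  have "F x \<in> U" if x: "x \<in> X" "seq_dist X nrm a x < e" for x
    using assms[OF a x(1)] a x e(2) by (auto simp: seq_dist_def dist_norm)
  then show "\<exists>r>0. \<forall>x. x \<in> X \<and> seq_dist X nrm a x < r \<longrightarrow> F x \<in> U" using e(1) by blast
qed simp

section \<open>The finite group of root-of-unity multipliers\<close>

text \<open>Multipliers of the operators in \<open>P\<^sub>N R\<close>, where \<open>P\<^sub>N\<close> truncates to the first \<open>N\<close>
  coordinates.\<close>

definition root_multipliers :: "nat \<Rightarrow> cseq set"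
  where "root_multipliers N = {\<theta>. (\<forall>i<N. \<theta> i ^ Suc i = 1) \<and> (\<forall>i\<ge>N. \<theta> i = 0)}"

lemma finite_root_multipliers: "finite (root_multipliers N)"
proof (rule finite_subset)
  \<comment> \<open>One finite set containing the possible values at every coordinate below
    \<open>N\<close>.\<close>
  let ?B = "\<Union>i<N. {w::complex. w ^ Suc i = 1}"
  let ?A = "{\<theta>. \<forall>i. (i \<in> {..<N} \<longrightarrow> \<theta> i \<in> ?B) \<and> (i \<notin> {..<N} \<longrightarrow> \<theta> i = 0)}"
  show "root_multipliers N \<subseteq> ?A"
    by (auto simp: root_multipliers_def)
  have "finite ?B" by (intro finite_UN_I finite_roots_unity) auto
  then show "finite ?A" by (intro finite_set_of_finite_funs finite_lessThan)
qed

lemma root_multipliers_mult: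
  assumes "\<theta> \<in> root_multipliers N" and "\<And>i. \<rho> i ^ Suc i = 1"
  shows "\<theta> * \<rho> \<in> root_multipliers N"
  using assms by (auto simp: root_multipliers_def power_mult_distrib simp del: power_Suc)

definition rotation_multiplier :: "(nat \<Rightarrow> nat) \<Rightarrow> cseq"
  where "rotation_multiplier k =
    (\<lambda>i. exp (2 * of_real pi * \<i> * of_nat (k i) / of_nat (i + 1)))"

lemma rotation_eq: "x \<in> X \<Longrightarrow> rotation X k x = rotation_multiplier k * x"
  by (simp add: rotation_def rotation_multiplier_def fun_eq_iff)

lemma rotation_multiplier_power: "rotation_multiplier k i ^ Suc i = 1"
  using complex_root_unity[of "Suc i" "k i"]
  by (simp add: rotation_multiplier_def del: power_Suc)

text \<open>Multiplication by a rotation permutes the root multipliers, with the pointwise inverse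
  undoing it. Averaging over them therefore yields \<open>R\<close>-invariance.\<close>

lemma sum_root_multipliers_rotate:
  "(\<Sum>\<theta>\<in>root_multipliers N. h (\<theta> * rotation_multiplier k)) = (\<Sum>\<theta>\<in>root_multipliers N. h \<theta>)"
proof (rule sum.reindex_bij_witness[of _ "\<lambda>\<theta>. \<theta> * (\<lambda>i. inverse (rotation_multiplier k i))"
      "\<lambda>\<theta>. \<theta> * rotation_multiplier k"])
  fix \<theta> assume "\<theta> \<in> root_multipliers N"
  then show "\<theta> * rotation_multiplier k \<in> root_multipliers N"
    "\<theta> * (\<lambda>i. inverse (rotation_multiplier k i)) \<in> root_multipliers N"
    by (auto intro!: root_multipliers_mult simp del: power_Suc
        simp: power_inverse rotation_multiplier_power)
qed (auto simp: fun_eq_iff rotation_multiplier_def)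

section \<open>Root multipliers preserve the unit ball\<close>

lemma RF_generator_eq:
  "x \<in> X \<Longrightarrow> RF_generator X m x = x(m := exp (2 * of_real pi * \<i> / of_nat (m + 1)) * x m)"
  by (auto simp: RF_generator_def rotation_def fun_eq_iff)

text \<open>Invariance is stated for the generators, which lie in both \<open>R\<close> and
  \<open>R_F\<close>, so that one locale serves both cases.\<close>

locale RF_invariant_ball = one_unconditional_sequence_space +
  assumes generator_ball: "RF_generator X m ` unit_cball X nrm \<subseteq> unit_cball X nrm"
begin

text \<open>Every such \<open>w\<close> is a power of the primitive root in
  \<open>RF_generator X m\<close>, so it is reached by iterating that generator.\<close>

lemma root_update_ball:
  assumes x: "x \<in> unit_cball X nrm" and w: "w ^ Suc m = 1"
  shows "x(m := w * x m) \<in> unit_cball X nrm"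
proof -
  let ?\<zeta> = "exp (2 * of_real pi * \<i> / of_nat (m + 1)) :: complex"
  have pow: "x(m := ?\<zeta> ^ k * x m) \<in> unit_cball X nrm" for k
  proof (induction k)
    case (Suc k)
    let ?y = "x(m := ?\<zeta> ^ k * x m)"
    have "RF_generator X m ?y \<in> unit_cball X nrm"
      using generator_ball Suc by blast
    also have "RF_generator X m ?y = ?y(m := ?\<zeta> * ?y m)"
      by (rule RF_generator_eq) (use Suc in \<open>unfold unit_cball_def, blast\<close>)
    also have "\<dots> = x(m := ?\<zeta> ^ Suc k * x m)"
      by (simp only: fun_upd_upd fun_upd_same power_Suc mult.assoc)
    finally show ?case .
  qed (use x in simp)
  have "w \<in> (\<lambda>k. cis (2 * pi * real k / real (Suc m))) ` {..<Suc m}"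
    using Complex.bij_betw_roots_unity[of "Suc m"] w unfolding bij_betw_def by blast
  then obtain k where "w = cis (2 * pi * real k / real (Suc m))" by blast
  also have "\<dots> = ?\<zeta> ^ k"
    by (simp add: cis_conv_exp mult.commute mult.left_commute flip: exp_of_nat_mult)
  finally show ?thesis using pow by simp
qed

text \<open>The first \<open>N\<close> coordinates are rotated one at a time; the remaining ones are
  then removed by truncation, which is a contraction.\<close>

lemma root_multiplier_ball:
  assumes \<theta>: "\<theta> \<in> root_multipliers N" and x: "x \<in> unit_cball X nrm"
  shows "\<theta> * x \<in> unit_cball X nrm"
proof -
  have *: "n \<le> N \<Longrightarrow> (\<lambda>i. if i < n then \<theta> i * x i else x i) \<in> unit_cball X nrm" for n
  proof (induction n)
    case 0
    then show ?case using x by simp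
  next
    case (Suc n)
    let ?y = "\<lambda>i. if i < n then \<theta> i * x i else x i"
    have "\<theta> n ^ Suc n = 1" using Suc.prems \<theta> by (auto simp: root_multipliers_def)
    then have "?y(n := \<theta> n * ?y n) \<in> unit_cball X nrm"
      using Suc by (intro root_update_ball) auto
    also have "?y(n := \<theta> n * ?y n) = (\<lambda>i. if i < Suc n then \<theta> i * x i else x i)"
      by (auto simp: fun_eq_iff)
    finally show ?case .
  qed
  define y where "y = (\<lambda>i. if i < N then \<theta> i * x i else x i)"
  have "y \<in> X" "nrm y \<le> 1" using *[of N] by (auto simp: y_def unit_cball_def)
  then have "truncate_seq N y \<in> unit_cball X nrm"
    using norm_truncate_seq_le[of y N] by (simp add: unit_cball_def truncate_seq_in_X)
  also have "truncate_seq N y = \<theta> * x"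
    using \<theta> by (auto simp: y_def truncate_seq_def root_multipliers_def fun_eq_iff)
  finally show ?thesis .
qed

lemma norm_root_multiplier_le:
  assumes \<theta>: "\<theta> \<in> root_multipliers N" and x: "x \<in> X"
  shows "nrm (\<theta> * x) \<le> nrm x"
proof (cases "x = 0")
  case True
  then have "\<theta> * x = x" by (simp add: fun_eq_iff)
  then show ?thesis by simp
next
  case False
  then have pos: "nrm x > 0" using norm_nonneg[OF x] norm_eq_zero[OF x] by force
  let ?c = "of_real (1 / nrm x) :: complex"
  have "?c *\<^sub>c x \<in> unit_cball X nrm"
    using pos x by (simp add: unit_cball_def X_scale norm_scale norm_divide)
  then have "\<theta> * (?c *\<^sub>c x) \<in> unit_cball X nrm" by (rule root_multiplier_ball[OF \<theta>])
  moreover have "\<theta> * x = of_real (nrm x) *\<^sub>c (\<theta> * (?c *\<^sub>c x))"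
    using pos by (simp add: cscale_def fun_eq_iff)
  ultimately show ?thesis
    using pos by (simp add: unit_cball_def norm_scale mult_left_le)
qed

section \<open>Construction of the separating polynomial\<close>

theorem ex_R_invariant_separating_polynomial:
  assumes z: "z \<in> X" "z \<notin> unit_cball X nrm"
  obtains k P where "continuous_homogeneous_polynomial X nrm k P"
    "invariant_function X (R_group X) P" "separates P z (unit_cball X nrm)"
proof -
  have "1 < nrm z" using z by (simp add: unit_cball_def)
  then obtain N where N: "1 < nrm (truncate_seq N z)" by (rule ex_norm_truncate_seq_gt[OF z(1)])
  obtain f where f_add: "\<And>x y. f (x + y) = f x + f y" and f_scale: "\<And>c x. f (c *\<^sub>c x) = c * f x"
    and f_le: "\<And>x. cmod (f x) \<le> nrm (truncate_seq N x)"
    and fz: "f (truncate_seq N z) = of_real (nrm (truncate_seq N (truncate_seq N z)))"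
  proof (rule complex_Hahn_Banach_seminorm[of cscale "\<lambda>x. nrm (truncate_seq N x)" "truncate_seq N z"])
    show "vector_space cscale" by (rule cseq.vector_space_axioms)
    have "truncate_seq N (x + y) = truncate_seq N x + truncate_seq N y" for x y
      by (auto simp: truncate_seq_def fun_eq_iff)
    then show "nrm (truncate_seq N (x + y)) \<le> nrm (truncate_seq N x) + nrm (truncate_seq N y)" for x y
      using norm_triangle[OF truncate_seq_in_X truncate_seq_in_X] by simp
    have "truncate_seq N (c *\<^sub>c x) = c *\<^sub>c truncate_seq N x" for c x
      by (auto simp: truncate_seq_def cscale_def fun_eq_iff)
    then show "nrm (truncate_seq N (c *\<^sub>c x)) = cmod c * nrm (truncate_seq N x)" for c x
      using norm_scale[OF truncate_seq_in_X] by simp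
  qed blast
  have f_le_mult: "cmod (f (\<theta> * x)) \<le> nrm x" if "\<theta> \<in> root_multipliers N" "x \<in> X" for \<theta> x
  proof -
    have "truncate_seq N (\<theta> * x) = \<theta> * x"
      using that by (auto simp: truncate_seq_def root_multipliers_def fun_eq_iff)
    then show ?thesis using f_le[of "\<theta> * x"] norm_root_multiplier_le[OF that] by simp
  qed
  have lin: "f (\<theta> * (c *\<^sub>c x + y)) = c * f (\<theta> * x) + f (\<theta> * y)" for \<theta> c x y
  proof -
    have "\<theta> * (c *\<^sub>c x + y) = c *\<^sub>c (\<theta> * x) + \<theta> * y"
      by (simp add: cscale_def fun_eq_iff algebra_simps)
    then show ?thesis by (simp add: f_add f_scale)
  qed
  \<comment> \<open>The identity of the group of multipliers: its term in the sum is
    \<open>f (truncate_seq N z)\<close>, of modulus greater than 1.\<close>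
  define \<iota> :: cseq where "\<iota> = truncate_seq N 1"
  have \<iota>: "\<iota> \<in> root_multipliers N" "\<iota> * z = truncate_seq N z"
    by (auto simp: \<iota>_def root_multipliers_def truncate_seq_def fun_eq_iff)
  have "truncate_seq N (truncate_seq N z) = truncate_seq N z" by (simp add: truncate_seq_def fun_eq_iff)
  then have "1 < cmod (f (\<iota> * z))" using N fz \<iota>(2) by simp
  \<comment> \<open>The threshold is the number of summands, each of which has modulus at most 1 on
    the ball for every exponent.\<close>
  then obtain k where
    k: "card (root_multipliers N) < cmod (\<Sum>\<theta>\<in>root_multipliers N. f (\<theta> * z) ^ k)"
    by (rule ex_large_power_sum[OF finite_root_multipliers \<iota>(1)])
  define P where "P x = (\<Sum>\<theta>\<in>root_multipliers N. f (\<theta> * x) ^ k)" for x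
  show thesis
  proof (rule that[of k P])
    have "homogeneous_polynomial X k P"
      unfolding P_def by (rule homogeneous_polynomial_sum_power) (rule lin)
    moreover have "continuous_map mtopology euclidean P"
      unfolding P_def
    proof (intro continuous_map_sum finite_root_multipliers)
      fix \<theta> assume \<theta>: "\<theta> \<in> root_multipliers N"
      have "continuous_map mtopology euclidean (\<lambda>x. f (\<theta> * x))"
      proof (rule continuous_map_contraction)
        fix x y assume "x \<in> X" "y \<in> X"
        moreover have "f (\<theta> * x) = f (\<theta> * (x - y)) + f (\<theta> * y)"
          using lin[of \<theta> 1 "x - y" y] by simp
        ultimately show "cmod (f (\<theta> * x) - f (\<theta> * y)) \<le> nrm (x - y)"
          using f_le_mult[OF \<theta> X_diff, of x y] by simp
      qed
      moreover have "continuous_map euclidean euclidean (\<lambda>w::complex. w ^ k)"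
        by (simp add: continuous_on_power)
      ultimately show "continuous_map mtopology euclidean (\<lambda>x. f (\<theta> * x) ^ k)"
        using continuous_map_compose[of mtopology euclidean "\<lambda>x. f (\<theta> * x)" euclidean "\<lambda>w. w ^ k"]
        by (simp add: o_def)
    qed
    ultimately show "continuous_homogeneous_polynomial X nrm k P"
      by (simp add: continuous_homogeneous_polynomial_def)
    show "invariant_function X (R_group X) P"
      unfolding invariant_function_def R_group_def
    proof (intro ballI, elim rangeE)
      fix \<gamma> x l assume "x \<in> X" "\<gamma> = rotation X l"
      \<comment> \<open>By associativity, rotating \<open>x\<close> amounts to shifting the
        summation index \<open>\<theta>\<close>.\<close>
      then have "P (\<gamma> x) = (\<Sum>\<theta>\<in>root_multipliers N. f (\<theta> * rotation_multiplier l * x) ^ k)"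
        by (simp add: P_def rotation_eq mult.assoc)
      also have "\<dots> = P x"
        unfolding P_def by (rule sum_root_multipliers_rotate)
      finally show "P (\<gamma> x) = P x" .
    qed
    have "cmod (P w) \<le> card (root_multipliers N)" if w: "w \<in> unit_cball X nrm" for w
    proof -
      have "cmod (f (\<theta> * w) ^ k) \<le> 1" if "\<theta> \<in> root_multipliers N" for \<theta>
        using f_le_mult[OF that, of w] w
        by (auto simp: unit_cball_def norm_power intro!: power_le_one)
      then have "(\<Sum>\<theta>\<in>root_multipliers N. cmod (f (\<theta> * w) ^ k)) \<le> (\<Sum>\<theta>\<in>root_multipliers N. 1)"
        by (rule sum_mono)
      then show ?thesis
        unfolding P_def using norm_sum[of "\<lambda>\<theta>. f (\<theta> * w) ^ k" "root_multipliers N"] by simp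
    qed
    then have "(SUP w\<in>unit_cball X nrm. ereal (cmod (P w))) \<le> ereal (card (root_multipliers N))"
      by (intro SUP_least) simp
    also have "\<dots> < ereal (cmod (P z))" using k by (simp add: P_def)
    finally show "separates P z (unit_cball X nrm)" by (simp add: separates_def)
  qed
qed

end

section \<open>Reduction of both groups to the generators\<close>

theorem corollary4p2:
  fixes X :: "cseq set" and nrm :: "cseq \<Rightarrow> real" and z :: cseq
  assumes "complex_banach_sequence_space X nrm"
    and "one_unconditional_basis X nrm unit_seq"
    and "acts_continuously X nrm (R_group X)"
    and "z \<in> X" and "z \<notin> unit_cball X nrm"
  shows "(invariant_set (R_group X) (unit_cball X nrm) \<longrightarrow>
           (\<exists>k P. continuous_homogeneous_polynomial X nrm k P \<and>
             invariant_function X (R_group X) P \<and> separates P z (unit_cball X nrm))) \<and>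
         (invariant_set (RF_group X) (unit_cball X nrm) \<longrightarrow>
           (\<exists>k P. continuous_homogeneous_polynomial X nrm k P \<and>
             invariant_function X (RF_group X) P \<and> separates P z (unit_cball X nrm)))"
proof -
  have R: "range (RF_generator X) \<subseteq> R_group X"
    by (auto simp: RF_generator_def R_group_def)
  \<comment> \<open>\<open>acts_continuously\<close> provides that \<open>R_group X\<close> is a
    subgroup, so it contains whatever its elements generate.\<close>
  have "RF_group X \<subseteq> R_group X"
    unfolding RF_group_def
    using assms(3) R by (intro group.generate_subgroup_incl group_BijGroup)
      (auto simp: acts_continuously_def)
  then have mono: "invariant_function X (R_group X) P \<Longrightarrow> invariant_function X (RF_group X) P" for P
    by (auto simp: invariant_function_def)
  have RF: "range (RF_generator X) \<subseteq> RF_group X"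
    unfolding RF_group_def by (auto intro: generate.incl)
  \<comment> \<open>\<open>\<Gamma>\<close> stands for either group; in both cases the polynomial
    found is invariant under the larger group \<open>R_group X\<close>, and \<open>mono\<close>
    passes this on to \<open>RF_group X\<close>.\<close>
  have *: "\<exists>k P. continuous_homogeneous_polynomial X nrm k P \<and>
             invariant_function X (R_group X) P \<and> separates P z (unit_cball X nrm)"
    if inv: "invariant_set \<Gamma> (unit_cball X nrm)" and \<Gamma>: "range (RF_generator X) \<subseteq> \<Gamma>" for \<Gamma>
  proof -
    interpret complex_banach_sequence_space X nrm by (rule assms(1))
    interpret RF_invariant_ball X nrm
      by unfold_locales (use assms(2) inv \<Gamma> in \<open>auto simp: invariant_set_def\<close>)
    show ?thesis using ex_R_invariant_separating_polynomial[OF assms(4,5)] by blast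
  qed
  show ?thesis using *[OF _ R] *[OF _ RF] mono by blast
qed

end
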